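(* Let $X$ be a Cantor set and $T:X\to X$ a minimal homeomorphism. Let $p:X\to\mathbb N=\{1,2,3,\dots\}$ be continuous and suppose that $S:X\to X$, $S(x)=T^{p(x)}(x)$, is a homeomorphism and is topologically transitive. Then $(X,S)$ is minimal.
   Context: Transitive means that some point of $X$ has a dense $S$-orbit. Minimal means that there is no non-empty closed invariant proper subset (equivalently, every orbit is dense). The map $S=T^p$ is called the speedup of $T$ with jump-function $p$. *)

theory Defs
  imports "HOL-Analysis.Analysis"
begin

(* The reference model is the Cantor space of 0-1 sequences. *)
definition Cantor_set :: "'a topology \<Rightarrow> bool" where
  "Cantor_set X \<longleftrightarrow>
     X homeomorphic_space
       product_topology (\<lambda>_::nat. discrete_topology (UNIV :: bool set)) UNIV"

(* The full orbit {f^n(x) | n integer} of x under a homeomorphism f of X.  The second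
   disjunct covers negative exponents: y = f^(-n)(x) means f^n(y) = x. *)
definition full_orbit :: "'a topology \<Rightarrow> ('a \<Rightarrow> 'a) \<Rightarrow> 'a \<Rightarrow> 'a set" where
  "full_orbit X f x = {y \<in> topspace X. \<exists>n::nat. y = (f ^^ n) x \<or> (f ^^ n) y = x}"

definition transitive_system :: "'a topology \<Rightarrow> ('a \<Rightarrow> 'a) \<Rightarrow> bool" where
  "transitive_system X f \<longleftrightarrow>
     (\<exists>x \<in> topspace X. X closure_of (full_orbit X f x) = topspace X)"

(* Invariance of A is f ` A = A, i.e. invariance under the integer action of f. *)
definition minimal_system :: "'a topology \<Rightarrow> ('a \<Rightarrow> 'a) \<Rightarrow> bool" where
  "minimal_system X f \<longleftrightarrow>
     \<not> (\<exists>A. closedin X A \<and> A \<noteq> {} \<and> A \<subset> topspace X \<and> f ` A = A)"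

definition speedup :: "('a \<Rightarrow> 'a) \<Rightarrow> ('a \<Rightarrow> nat) \<Rightarrow> 'a \<Rightarrow> 'a" where
  "speedup T p x = (T ^^ p x) x"

end

theory Submission
  imports Defs
begin

text \<open>
  If \<open>A\<close> is closed, non-empty and invariant under \<open>S = T\<^sup>p\<close> and \<open>p \<le> N\<close>, then
  \<open>A \<union> T A \<union> \<dots> \<union> T\<^sup>N A\<close> is closed and mapped into itself by \<open>T\<close>, hence equals \<open>X\<close>
  by minimality and compactness. So some \<open>T\<^sup>i A\<close>, and with it \<open>A\<close>, has interior points. A dense
  \<open>S\<close>-orbit meets the interior of \<open>A\<close>, so by invariance it lies in \<open>A\<close>, and \<open>A = X\<close>.
\<close>

lemma Cantor_set_imp_compact_space:
  assumes "Cantor_set X"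
  shows "compact_space X"
  using assms unfolding Cantor_set_def
  by (simp add: homeomorphic_compact_space compact_space_product_topology compact_space_discrete_topology)

lemma homeomorphic_map_funpow:
  assumes "homeomorphic_map X X f"
  shows "homeomorphic_map X X (f ^^ n)"
proof (induction n)
  case 0
  then show ?case by (simp flip: id_def)
next
  case (Suc n)
  then show ?case
    using homeomorphic_map_compose[OF Suc assms] by (simp only: funpow.simps)
qed

lemma funpow_image_comp: "(f ^^ Suc n) ` A = (f ^^ n) ` f ` A"
  by (simp only: funpow_Suc_right image_comp)

text \<open>Minimality only excludes closed sets that \<open>T\<close> maps onto themselves, so
  \<open>B\<close> is replaced by the intersection of its decreasing forward images. Compactness
  keeps this core non-empty.\<close>

lemma minimal_system_forward_invariant:
  assumes "compact_space X" and hom: "homeomorphic_map X X T" and "minimal_system X T"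
    and "closedin X B" and "B \<noteq> {}" and sub: "T ` B \<subseteq> B"
  shows "B = topspace X"
proof -
  define C where "C = (\<lambda>n. (T ^^ n) ` B)"
  have BX: "B \<subseteq> topspace X"
    using assms(4) by (rule closedin_subset)
  have inj: "inj_on T (topspace X)"
    using hom by (rule homeomorphic_imp_injective_map)
  have closed: "closedin X (C n)" for n
    using homeomorphic_map_closedness[OF homeomorphic_map_funpow[OF hom] BX] assms(4)
    by (simp add: C_def)
  have C_Suc: "C (Suc n) = T ` C n" for n
    by (simp add: C_def image_comp)
  have step: "C (Suc n) \<subseteq> C n" for n
    unfolding C_def funpow_image_comp using sub by (rule image_mono)
  have decr: "decseq C"
    using step by (rule decseq_SucI)
  have ne: "(\<Inter>n. C n) \<noteq> {}"
    using assms(1) closed assms(5) decr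
    by (intro compact_space_imp_nest) (simp_all add: C_def)
  \<comment> \<open>Injectivity lets \<open>T\<close> commute with the intersection;
    \<open>j = 0\<close> witnesses that the index set is non-empty.\<close>
  have "T ` (\<Inter>n. C n) = (\<Inter>n. T ` C n)"
    using closedin_subset[OF closed] by (intro image_INT[OF inj, where j = 0]) auto
  also have "\<dots> = (\<Inter>n. C (Suc n))"
    by (simp add: C_Suc)
  \<comment> \<open>Dropping \<open>C 0\<close> loses nothing, since it contains
    \<open>C 1\<close>.\<close>
  also have "\<dots> = (\<Inter>n. C n)"
    using step by blast
  finally have "T ` (\<Inter>n. C n) = (\<Inter>n. C n)" .
  moreover have "closedin X (\<Inter>n. C n)"
    using closed by blast
  ultimately have "(\<Inter>n. C n) = topspace X"
    using assms(3) ne closedin_subset[of X "\<Inter>n. C n"]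
    unfolding minimal_system_def psubset_eq by metis
  moreover have "(\<Inter>n. C n) \<subseteq> B"
    using INT_lower[of 0 UNIV C] by (simp add: C_def)
  ultimately show ?thesis
    using BX by blast
qed

text \<open>A finite Baire argument: removing a closed set without interior from a non-empty open
  set leaves a non-empty open set.\<close>

lemma interior_of_UN_closed_eq_empty:
  assumes "finite I" and "\<And>i. i \<in> I \<Longrightarrow> closedin X (C i)"
    and "\<And>i. i \<in> I \<Longrightarrow> X interior_of (C i) = {}"
  shows "X interior_of (\<Union>i\<in>I. C i) = {}"
  using assms
proof (induction I)
  case empty
  then show ?case by simp
next
  case (insert i I)
  then show ?case
    using interior_of_union_eq_empty[of X "C i" "\<Union>i\<in>I. C i"] by simp
qed

text \<open>Only the top level \<open>i = N\<close> is at stake. There \<open>p a\<close> of the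
  \<open>N + 1\<close> steps merge into one application of the speedup, which stays in
  \<open>A\<close>, and at most \<open>N\<close> steps remain because \<open>p a\<close> is
  positive.\<close>

lemma speedup_iterates_forward_invariant:
  assumes "speedup T p ` A \<subseteq> A" and bound: "\<And>x. x \<in> A \<Longrightarrow> 1 \<le> p x \<and> p x \<le> N"
  shows "T ` (\<Union>i\<le>N. (T ^^ i) ` A) \<subseteq> (\<Union>i\<le>N. (T ^^ i) ` A)"
proof clarify
  fix i a assume i: "i \<le> N" and a: "a \<in> A"
  show "T ((T ^^ i) a) \<in> (\<Union>i\<le>N. (T ^^ i) ` A)"
  proof (cases "Suc i \<le> N")
    case True
    then show ?thesis
      using a by (intro UN_I[of "Suc i"]) auto
  next
    case False
    \<comment> \<open>The bound \<open>p a \<le> N\<close> keeps this subtraction from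
      truncating.\<close>
    define j where "j = Suc i - p a"
    have j: "j + p a = Suc i" "j \<le> N"
      using False i bound[OF a] by (auto simp: j_def)
    have "T ((T ^^ i) a) = (T ^^ (j + p a)) a"
      by (simp add: j(1))
    also have "\<dots> = (T ^^ j) (speedup T p a)"
      by (simp add: funpow_add speedup_def)
    finally show ?thesis
      using assms(1) a j(2) by auto
  qed
qed

text \<open>By injectivity no point outside \<open>A\<close> can enter \<open>A\<close>, so
  membership is preserved along forward and backward iteration alike.\<close>

lemma full_orbit_mem_invariant_set_iff:
  assumes inj: "inj_on f (topspace X)" and maps: "f ` topspace X \<subseteq> topspace X"
    and AX: "A \<subseteq> topspace X" and inv: "f ` A = A"
    and x: "x \<in> topspace X" and y: "y \<in> full_orbit X f x"
  shows "y \<in> A \<longleftrightarrow> x \<in> A"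
proof -
  have step: "f z \<in> A \<longleftrightarrow> z \<in> A" if "z \<in> topspace X" for z
    using inj_on_image_mem_iff[OF inj that AX] inv by simp
  \<comment> \<open>Membership in the space is carried through the induction because
    \<open>step\<close> applies only there.\<close>
  have "(f ^^ n) z \<in> topspace X \<and> ((f ^^ n) z \<in> A \<longleftrightarrow> z \<in> A)" if "z \<in> topspace X" for n z
    using that maps step by (induction n) auto
  then show ?thesis
    using x y unfolding full_orbit_def by blast
qed

lemma transitive_system_invariant_interior:
  assumes "homeomorphic_map X X f" and "transitive_system X f"
    and cl: "closedin X A" and inv: "f ` A = A" and int: "X interior_of A \<noteq> {}"
  shows "A = topspace X"
proof -
  obtain x where x: "x \<in> topspace X" and dense: "X closure_of (full_orbit X f x) = topspace X"
    using assms(2) unfolding transitive_system_def by blast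
  have AX: "A \<subseteq> topspace X"
    using cl by (rule closedin_subset)
  have orbit: "y \<in> A \<longleftrightarrow> x \<in> A" if "y \<in> full_orbit X f x" for y
    using full_orbit_mem_invariant_set_iff[OF homeomorphic_imp_injective_map _ AX inv x that]
      homeomorphic_imp_surjective_map assms(1) by blast
  have "full_orbit X f x \<inter> X interior_of A \<noteq> {}"
    using dense int openin_interior_of[of X A] by (simp add: dense_intersects_open)
  \<comment> \<open>The base point need not lie in the interior: membership goes from an orbit point
    back to \<open>x\<close>, then from \<open>x\<close> to the whole orbit.\<close>
  then have "x \<in> A"
    using orbit interior_of_subset[of X A] by blast
  then have "full_orbit X f x \<subseteq> A"
    using orbit by blast
  then show ?thesis
    using closure_of_minimal[OF _ cl] dense AX by blast
qed

lemma homeomorphic_map_interior_of_image: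
  assumes "homeomorphic_map X X f" and "A \<subseteq> topspace X" and "X interior_of (f ` A) \<noteq> {}"
  shows "X interior_of A \<noteq> {}"
  using homeomorphic_map_interior_of[OF assms(1,2)] assms(3) by simp

theorem proposition2p1:
  fixes X :: "'a topology" and T :: "'a \<Rightarrow> 'a" and p :: "'a \<Rightarrow> nat"
  assumes "Cantor_set X"
    and "homeomorphic_map X X T"
    and "minimal_system X T"
    and "continuous_map X (discrete_topology {1..}) p"
    and "homeomorphic_map X X (speedup T p)"
    and "transitive_system X (speedup T p)"
  shows "minimal_system X (speedup T p)"
proof -
  have compact: "compact_space X"
    using assms(1) by (rule Cantor_set_imp_compact_space)
  \<comment> \<open>A compact subset of a discrete space is finite, so the jumps have a common bound
    \<open>N\<close>.\<close>
  have "finite (p ` topspace X)"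
    using image_compactin[OF _ assms(4)] compact
    by (simp add: compact_space_def compactin_discrete_topology)
  then obtain N where N: "\<And>x. x \<in> topspace X \<Longrightarrow> p x \<le> N"
    by (meson finite_nat_set_iff_bounded_le imageI)
  have p1: "1 \<le> p x" if "x \<in> topspace X" for x
    using continuous_map_image_subset_topspace[OF assms(4)] that by auto
  have "A = topspace X"
    if cl: "closedin X A" and ne: "A \<noteq> {}" and inv: "speedup T p ` A = A" for A
  proof -
    have AX: "A \<subseteq> topspace X"
      using cl by (rule closedin_subset)
    have hom: "homeomorphic_map X X (T ^^ i)" for i
      using assms(2) by (rule homeomorphic_map_funpow)
    have closed: "closedin X ((T ^^ i) ` A)" for i
      using homeomorphic_map_closedness[OF hom AX] cl by simp
    have "(\<Union>i\<le>N. (T ^^ i) ` A) = topspace X"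
    proof (rule minimal_system_forward_invariant[OF compact assms(2,3)])
      show "closedin X (\<Union>i\<le>N. (T ^^ i) ` A)"
        using closed by (intro closedin_Union) auto
      show "(\<Union>i\<le>N. (T ^^ i) ` A) \<noteq> {}"
        using ne by auto
      show "T ` (\<Union>i\<le>N. (T ^^ i) ` A) \<subseteq> (\<Union>i\<le>N. (T ^^ i) ` A)"
        using inv AX N p1 by (intro speedup_iterates_forward_invariant[where p = p]) auto
    qed
    then have "X interior_of (\<Union>i\<le>N. (T ^^ i) ` A) \<noteq> {}"
      using ne AX by auto
    then obtain i where "X interior_of ((T ^^ i) ` A) \<noteq> {}"
      using interior_of_UN_closed_eq_empty[of "{..N}" X "\<lambda>i. (T ^^ i) ` A"] closed by auto
    then have "X interior_of A \<noteq> {}"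
      by (rule homeomorphic_map_interior_of_image[OF hom AX])
    then show "A = topspace X"
      by (rule transitive_system_invariant_interior[OF assms(5,6) cl inv])
  qed
  then show ?thesis
    unfolding minimal_system_def by blast
qed

end
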